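(* Let $q$ be an odd prime power with $q\equiv 1\pmod 3$, let $m=(q-1)/3$, and let $\gamma$ be a generator of the multiplicative group $\mathbf{F}_q^*$. For $k\in\{0,1,\dots,m-1\}$ define $a,b,c,d,e,f\in\mathbf{F}_q^*$ by $$a=\frac{2\gamma^{3k+1}}{3},\quad b=\frac{\gamma^{2m}}{3},\quad c=\frac{-\gamma^{2m+3k+1}}{3},\quad d=\frac{\gamma^{m}}{3},\quad e=\frac{-\gamma^{m+3k+1}}{3},\quad f=\frac{1}{3}.$$ Then the polynomial $$g(x)=ax^{3m-1}+bx^{2m+1}+cx^{2m-1}+dx^{m+1}+ex^{m-1}+fx$$ is a permutation polynomial over $\mathbf{F}_q$, and the permutation of $\mathbf{F}_q$ it induces is an involution with exactly $m+1$ fixed points.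
   Context: $\mathbf{F}_q$ denotes the finite field with $q$ elements. A permutation polynomial over $\mathbf{F}_q$ is a polynomial $g\in\mathbf{F}_q[x]$ whose associated map $\mathbf{F}_q\to\mathbf{F}_q$, $x\mapsto g(x)$, is a bijection; it is involutory if $g(g(x))=x$ for all $x\in\mathbf{F}_q$. *)

theory Defs
  imports "HOL-Computational_Algebra.Polynomial" "HOL-Number_Theory.Prime_Powers" "HOL-Number_Theory.Cong" "HOL-Library.Cardinality"
begin

definition permutation_poly :: "'a::{field,finite} poly \<Rightarrow> bool" where
  "permutation_poly g \<longleftrightarrow> bij (poly g)"

definition involutory_poly :: "'a::{field,finite} poly \<Rightarrow> bool" where
  "involutory_poly g \<longleftrightarrow> (\<forall>x. poly g (poly g x) = x)"

definition generates_units :: "'a::field \<Rightarrow> bool" where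
  "generates_units \<gamma> \<longleftrightarrow> range (\<lambda>i::int. \<gamma> powi i) = UNIV - {0}"

end

theory Submission imports Defs begin

text \<open>
  Write \<open>\<omega> = \<gamma>^m\<close>, a primitive cube root of unity, and \<open>A = \<gamma>^(3k+1)\<close>, so that \<open>A^m = \<omega>\<close>. For \<open>x \<noteq> 0\<close>
  the power \<open>t = x^m\<close> is a cube root of unity, and the coefficients are chosen so that \<open>g x = A / x\<close>
  when \<open>t \<in> {1, \<omega>}\<close> and \<open>g x = x\<close> when \<open>t = \<omega>\<^sup>2\<close>. Since \<open>(A / x)^m = \<omega> / t\<close>, the map
  \<open>x \<mapsto> A / x\<close> swaps the classes \<open>t = 1\<close> and \<open>t = \<omega>\<close>. The fixed points are therefore \<open>0\<close> and the
  class \<open>t = \<omega>\<^sup>2\<close>, which has \<open>m\<close> elements.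
\<close>

text \<open>Translation by 1 permutes the ring, so summing all elements before and after it gives
  the same total.\<close>

lemma of_nat_card_UNIV_eq_0: "of_nat CARD('a) = (0 :: 'a::{ring_1,finite})"
proof -
  have "(\<Sum>x\<in>(UNIV::'a set). x) = (\<Sum>x\<in>UNIV. x + 1)"
    by (rule sum.reindex_bij_witness[of _ "\<lambda>x. x + 1" "\<lambda>x. x - 1"]) auto
  also have "\<dots> = (\<Sum>x\<in>UNIV. x) + of_nat CARD('a)"
    by (simp add: sum.distrib)
  finally show ?thesis by simp
qed

text \<open>Multiplication by \<open>x\<close> permutes the units, and their product is nonzero and
  cancels.\<close>

lemma finite_field_pow_card_minus_1:
  fixes x :: "'a::{field,finite}"
  assumes "x \<noteq> 0"
  shows "x ^ (CARD('a) - 1) = 1"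
proof -
  have "(\<Prod>y\<in>UNIV - {0::'a}. y) = (\<Prod>y\<in>UNIV - {0}. x * y)"
    by (rule prod.reindex_bij_witness[of _ "\<lambda>y. x * y" "\<lambda>y. y / x"]) (use assms in auto)
  also have "\<dots> = x ^ (CARD('a) - 1) * (\<Prod>y\<in>UNIV - {0}. y)"
    by (simp add: prod.distrib card_Diff_singleton)
  finally show ?thesis by simp
qed

lemma card_nth_roots_le:
  fixes c :: "'a::idom"
  assumes "n > 0"
  shows "card {x. x ^ n = c} \<le> n"
proof -
  let ?p = "monom 1 n - [:c:]"
  have "coeff ?p n = 1" using assms by (simp add: coeff_pCons split: nat.split)
  then have "?p \<noteq> 0" by (metis coeff_0 zero_neq_one)
  have "degree ?p \<le> n"
    by (intro degree_diff_le degree_monom_le) simp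
  moreover have "{x. x ^ n = c} = {x. poly ?p x = 0}" by (auto simp: poly_monom)
  ultimately show ?thesis
    using card_poly_roots_bound[OF \<open>?p \<noteq> 0\<close>] by simp
qed

text \<open>The relation on \<open>w\<close> makes
  \<open>(t - 1) * (t - w) * (t - w\<^sup>2)\<close> equal to \<open>t ^ 3 - 1\<close>.\<close>

lemma cube_root_of_unity_cases:
  fixes t w :: "'a::idom"
  assumes w: "1 + w + w\<^sup>2 = 0" and t: "t ^ 3 = 1"
  shows "t = 1 \<or> t = w \<or> t = w\<^sup>2"
proof -
  have "(t - 1) * (t - w) * (t - w\<^sup>2) = 0"
    using w t by algebra
  then show ?thesis by simp
qed

theorem theorem2p6:
  fixes \<gamma> a b c d e f :: "'a::{field,finite}"
    and g :: "'a poly"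
    and q m k :: nat
  assumes "q = CARD('a)" and "primepow q" and "odd q" and "[q = 1] (mod 3)"
    and "m = (q - 1) div 3"
    and "generates_units \<gamma>"
    and "k \<in> {0..<m}"
    and "a = 2 * \<gamma> ^ (3 * k + 1) / 3"
    and "b = \<gamma> ^ (2 * m) / 3"
    and "c = - (\<gamma> ^ (2 * m + 3 * k + 1)) / 3"
    and "d = \<gamma> ^ m / 3"
    and "e = - (\<gamma> ^ (m + 3 * k + 1)) / 3"
    and "f = 1 / 3"
    and "g = monom a (3 * m - 1) + monom b (2 * m + 1) + monom c (2 * m - 1)
           + monom d (m + 1) + monom e (m - 1) + monom f 1"
  shows "{a, b, c, d, e, f} \<subseteq> UNIV - {0} \<and>
    permutation_poly g \<and> involutory_poly g \<and> card {x. poly g x = x} = m + 1"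
proof -
  define w where "w = \<gamma> ^ m"
  define A where "A = \<gamma> ^ (3 * k + 1)"
  have q0: "of_nat q = (0::'a)" using assms(1) of_nat_card_UNIV_eq_0 by simp
  have m0: "m > 0" using assms(7) by simp
  have qm: "q = 3 * m + 1"
    using assms(4,5) m0 by (auto simp: cong_def) presburger
  have "even m" using \<open>odd q\<close> qm by simp
  \<comment> \<open>This keeps the exponent \<open>m - 1\<close> positive, so that every monomial of
    \<open>g\<close> vanishes at 0.\<close>
  then have m2: "m \<ge> 2" using m0 by presburger
  \<comment> \<open>In the field \<open>3 * m + 1 = 0\<close>, so \<open>3 = 0\<close> would give
    \<open>1 = 0\<close>.\<close>
  have three: "(3::'a) \<noteq> 0" using q0 qm by auto
  have two: "(2::'a) \<noteq> 0"
  proof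
    assume two0: "(2::'a) = 0"
    obtain n where "q = 2 * n + 1" using \<open>odd q\<close> oddE by blast
    with q0 two0 show False by simp
  qed
  have g0: "\<gamma> \<noteq> 0"
  proof
    assume "\<gamma> = 0"
    then have "\<gamma> powi 1 \<notin> UNIV - {0}" by simp
    then show False using assms(6) unfolding generates_units_def by blast
  qed
  have A0: "A \<noteq> 0" using g0 by (simp add: A_def)
  have fermat: "x ^ (3 * m) = 1" if "x \<noteq> 0" for x :: 'a
    using finite_field_pow_card_minus_1[OF that] qm assms(1) by simp
  have w3: "w ^ 3 = 1" using fermat[OF g0] by (simp add: w_def mult.commute flip: power_mult)
  \<comment> \<open>Otherwise all \<open>3 * m\<close> units, being powers of
    \<open>\<gamma>\<close>, would be roots of \<open>x ^ m = 1\<close>, which has at most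
    \<open>m\<close> roots.\<close>
  have w1: "w \<noteq> 1"
  proof
    assume "w = 1"
    have "x ^ m = 1" if "x \<noteq> 0" for x :: 'a
    proof -
      from that obtain i :: int where "x = \<gamma> powi i"
        using assms(6) unfolding generates_units_def by blast
      then have "x ^ m = (\<gamma> ^ m) powi i"
        by (simp flip: power_int_of_nat power_int_mult add: mult.commute)
      then show ?thesis using \<open>w = 1\<close> by (simp add: w_def)
    qed
    then have "UNIV - {0::'a} \<subseteq> {x. x ^ m = 1}" by auto
    then have "card (UNIV - {0::'a}) \<le> card {x::'a. x ^ m = 1}" by (intro card_mono) auto
    also have "\<dots> \<le> m" by (rule card_nth_roots_le[OF m0])
    finally show False using m0 qm assms(1) by (simp add: card_Diff_singleton)
  qed
  have w: "1 + w + w\<^sup>2 = 0"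
  proof -
    have "(w - 1) * (1 + w + w\<^sup>2) = 0" using w3 by algebra
    then show ?thesis using w1 by simp
  qed
  have w0: "w \<noteq> 0" using w3 by auto
  have Am: "A ^ m = w"
  proof -
    have "A ^ m = (\<gamma> ^ (3 * m)) ^ k * \<gamma> ^ m"
      by (simp add: A_def algebra_simps power_add flip: power_mult)
    then show ?thesis using fermat[OF g0] by (simp add: w_def)
  qed
  have coeffs: "a = 2 * A / 3" "b = w\<^sup>2 / 3" "c = - (w\<^sup>2 * A) / 3" "d = w / 3" "e = - (w * A) / 3"
    using assms(8-12) by (simp_all add: A_def w_def power_add power_even_eq mult.assoc)
  have classes: "x ^ m = 1 \<or> x ^ m = w \<or> x ^ m = w\<^sup>2" if "x \<noteq> 0" for x :: 'a
    using fermat[OF that]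
    by (intro cube_root_of_unity_cases[OF w]) (simp add: mult.commute flip: power_mult)

  have poly0: "poly g 0 = 0"
    using m2 by (simp add: assms(14) poly_monom power_0_left)
  \<comment> \<open>Reduce the exponents by \<open>x ^ (3 * m) = 1\<close> and collect the terms in
    \<open>A / x\<close> and in \<open>x\<close>; both brackets depend only on the class
    \<open>x ^ m\<close>.\<close>
  have polyx: "poly g x = (A / x * (2 - w\<^sup>2 * (x ^ m)\<^sup>2 - w * x ^ m)
      + x * (w\<^sup>2 * (x ^ m)\<^sup>2 + w * x ^ m + 1)) / 3" if "x \<noteq> 0" for x
  proof -
    have "x ^ (3 * m - 1) = 1 / x"
      using that m0 fermat[OF that] by (simp add: power_diff)
    moreover have "x ^ (2 * m - 1) = (x ^ m)\<^sup>2 / x"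
      using that m0 by (simp add: power_diff power_even_eq)
    moreover have "x ^ (m - 1) = x ^ m / x"
      using that m0 by (simp add: power_diff)
    moreover have "x ^ (2 * m + 1) = (x ^ m)\<^sup>2 * x" "x ^ (m + 1) = x ^ m * x"
      by (simp_all add: power_even_eq)
    ultimately show ?thesis
      by (auto simp: assms(13,14) poly_monom coeffs algebra_simps add_divide_distrib diff_divide_distrib)
  qed
  have swap: "poly g x = A / x" if "x \<noteq> 0" "x ^ m = 1 \<or> x ^ m = w" for x
  proof -
    \<comment> \<open>This is the second bracket for \<open>x ^ m = w\<close>; for
      \<open>x ^ m = 1\<close> the bracket is \<open>1 + w + w\<^sup>2\<close> itself.\<close>
    have "w\<^sup>2 * w\<^sup>2 + w * w + 1 = (1 + w + w\<^sup>2) * (1 - w + w\<^sup>2)"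
      by (simp add: algebra_simps power2_eq_square)
    with that(2) w have zero: "w\<^sup>2 * (x ^ m)\<^sup>2 + w * x ^ m + 1 = 0"
      by (auto simp: add_ac)
    \<comment> \<open>The two brackets add up to 3, so when the second vanishes the first cancels
      the denominator.\<close>
    have three_minus: "2 - w\<^sup>2 * (x ^ m)\<^sup>2 - w * x ^ m = 3 - (w\<^sup>2 * (x ^ m)\<^sup>2 + w * x ^ m + 1)"
      by simp
    show ?thesis unfolding polyx[OF that(1)] three_minus zero using three by simp
  qed
  have fixed: "poly g x = x" if "x \<noteq> 0" "x ^ m = w\<^sup>2" for x
  proof -
    \<comment> \<open>Both products equal 1, so the brackets become \<open>2 - 1 - 1 = 0\<close> and
      \<open>1 + 1 + 1 = 3\<close>.\<close>
    have "w\<^sup>2 * (w\<^sup>2)\<^sup>2 = (w ^ 3)\<^sup>2" "w * w\<^sup>2 = w ^ 3"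
      by (simp_all add: power2_eq_square power3_eq_cube)
    then show ?thesis unfolding polyx[OF that(1)] that(2) using three w3 by simp
  qed
  have inv: "poly g (poly g x) = x" for x
  proof -
    consider "x = 0" | "x \<noteq> 0" "x ^ m = w\<^sup>2" | "x \<noteq> 0" "x ^ m = 1 \<or> x ^ m = w"
      using classes by blast
    then show ?thesis
    proof cases
      case 3
      then have "(A / x) ^ m = 1 \<or> (A / x) ^ m = w"
        using Am w0 by (auto simp: power_divide)
      then show ?thesis using 3 swap A0 by simp
    qed (simp_all add: poly0 fixed)
  qed

  have fp: "{x. poly g x = x} = insert 0 {x. x ^ m = w\<^sup>2}"
  proof -
    have "poly g x \<noteq> x" if "x \<noteq> 0" "x ^ m = 1 \<or> x ^ m = w" for x
    proof
      assume "poly g x = x"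
      \<comment> \<open>But \<open>A / x\<close> lies in the other one of the classes 1 and
        \<open>w\<close>, and these differ.\<close>
      then have "(A / x) ^ m = x ^ m" using swap[OF that] by simp
      then show False using that(2) Am w1 w0 by (auto simp: power_divide)
    qed
    moreover have "x \<noteq> 0" if "x ^ m = w\<^sup>2" for x
      using that m0 w0 by (auto simp: power_0_left)
    ultimately show ?thesis using poly0 fixed classes by blast
  qed
  \<comment> \<open>The three classes cover \<open>3m\<close> units and have at most \<open>m\<close> elements each.\<close>
  have "card {x. x ^ m = w\<^sup>2} = m"
  proof -
    have "UNIV - {0::'a} \<subseteq> {x. x ^ m = 1} \<union> {x. x ^ m = w} \<union> {x. x ^ m = w\<^sup>2}"
      using classes by blast
    then have "card (UNIV - {0::'a}) \<le> card ({x. x ^ m = 1} \<union> {x. x ^ m = w} \<union> {x. x ^ m = w\<^sup>2})"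
      by (intro card_mono) auto
    also have "\<dots> \<le> card {x::'a. x ^ m = 1} + card {x. x ^ m = w} + card {x. x ^ m = w\<^sup>2}"
      by (meson add_le_mono1 card_Un_le order_trans)
    finally have "3 * m \<le> card {x::'a. x ^ m = 1} + card {x. x ^ m = w} + card {x. x ^ m = w\<^sup>2}"
      using qm assms(1) by (simp add: card_Diff_singleton)
    then show ?thesis
      using card_nth_roots_le[OF m0, of "1::'a"] card_nth_roots_le[OF m0, of w]
        card_nth_roots_le[OF m0, of "w\<^sup>2"] by linarith
  qed
  then have "card {x. poly g x = x} = m + 1"
    \<comment> \<open>Since \<open>0 ^ m = 0\<close> differs from \<open>w\<^sup>2\<close>, the
      point 0 is a further fixed point outside the class.\<close>
    using m0 w0 by (simp add: fp power_0_left)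
  moreover have "bij (poly g)"
    using inv by (rule involuntory_imp_bij)
  moreover have "{a, b, c, d, e, f} \<subseteq> UNIV - {0}"
    unfolding coeffs assms(13) using A0 w0 two three by simp
  ultimately show ?thesis
    using inv by (simp add: permutation_poly_def involutory_poly_def)
qed

end
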